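(* Let $G$ be a finite bipartite graph with color classes $V_1$ and $V_2$. If $$\sum_{v\in V_2}\deg(v)(\deg(v)-1)\geq |V_1|(|V_1|-1),$$ then for every $x\in(-1,1)$ $$\tau(G,x)\geq(1-x^2)^{|E(G)|}.$$
   Context: Graphs are finite and simple. For a finite graph $G=(V,E)$ and $x\in(-1,1)$, $\Psi(G,x)$ is the set of real $V\times V$ matrices $M$ such that (1) $M$ is (symmetric) positive definite, (2) every diagonal entry of $M$ is $1$, (3) $M_{i,j}=x$ for every edge $(i,j)$ of $G$. When $\Psi(G,x)$ is nonempty (which is always the case for bipartite $G$), there is a unique matrix $\Sigma(G,x)\in\Psi(G,x)$ maximizing the determinant on $\Psi(G,x)$, and $\tau(G,x):=\det(\Sigma(G,x))$. *)

theory Defs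
  imports "HOL-Analysis.Analysis"
begin

text \<open>
  The vertex set of a graph is the finite type \<open>'v\<close>, so that real \<open>V \<times> V\<close> matrices are
  elements of \<^typ>\<open>real^'v^'v\<close>.  A graph is given by its set of edges, an (undirected) edge
  being the two-element set of its endpoints.
\<close>

definition simple_graph :: "'v::finite set set \<Rightarrow> bool" where
  "simple_graph E \<longleftrightarrow> (\<forall>e\<in>E. card e = 2)"

definition vdeg :: "'v::finite set set \<Rightarrow> 'v \<Rightarrow> nat" where
  "vdeg E v = card {e \<in> E. v \<in> e}"

text \<open>The colour classes are not required to be nonempty.\<close>

definition bipartite_with :: "'v::finite set set \<Rightarrow> 'v set \<Rightarrow> 'v set \<Rightarrow> bool" where
  "bipartite_with E V1 V2 \<longleftrightarrow>
     V1 \<union> V2 = UNIV \<and> V1 \<inter> V2 = {} \<and> (\<forall>e\<in>E. \<exists>u\<in>V1. \<exists>v\<in>V2. e = {u, v})"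

definition positive_definite :: "real^'v^'v \<Rightarrow> bool" where
  "positive_definite M \<longleftrightarrow> transpose M = M \<and> (\<forall>z. z \<noteq> 0 \<longrightarrow> z \<bullet> (M *v z) > 0)"

definition Psi :: "'v::finite set set \<Rightarrow> real \<Rightarrow> (real^'v^'v) set" where
  "Psi E x = {M. positive_definite M \<and> (\<forall>i. M $ i $ i = 1) \<and>
                 (\<forall>i j. {i, j} \<in> E \<longrightarrow> M $ i $ j = x)}"

text \<open>
  The determinant has a unique maximizer on \<open>Psi E x\<close> whenever this set is nonempty
  (in particular for bipartite graphs), so \<open>arg_max\<close> picks that matrix.
\<close>

definition Sigma_mat :: "'v::finite set set \<Rightarrow> real \<Rightarrow> real^'v^'v" where
  "Sigma_mat E x = arg_max det (\<lambda>M. M \<in> Psi E x)"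

definition tau :: "'v::finite set set \<Rightarrow> real \<Rightarrow> real" where
  "tau E x = det (Sigma_mat E x)"

end

theory Submission
  imports Defs
begin

text \<open>
  The determinant of any single member of \<open>\<Psi>(G,x)\<close> bounds \<open>\<tau>(G,x)\<close> from below
  (\<open>tau_ge_det\<close>), so it is enough to exhibit one good covariance matrix.

  Write \<open>y = x\<^sup>2\<close>, \<open>n = |V1|\<close>, and \<open>d v\<close> for the degree of \<open>v\<close>.  Take unit-variance Gaussians
  on \<open>V1\<close> with all pairwise covariances equal to \<open>y\<close>, and adjoin each \<open>v \<in> V2\<close> as a multiple
  of the sum of its neighbours plus independent noise.  The multiple
  \<open>c v = x / (1 + (d v - 1) y)\<close> is forced by asking for covariance \<open>x\<close> with each neighbour, and
  unit variance then leaves the noise the variance \<open>(1 - y) / (1 + (d v - 1) y)\<close>.  The value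
  \<open>y\<close> is the covariance that a common neighbour induces between the leaves of a star, for which
  the claimed bound is sharp.  The change of variables is unipotent, so (\<open>Psi_bipartite_witness\<close>)
  the determinant of the covariance matrix is
  \<open>(1 - y)^(n-1) (1 + (n-1) y) \<Prod>v. (1 - y) / (1 + (d v - 1) y)\<close>.

  Put \<open>g k = (k - 1) ln (1 - y) + ln (1 + (k - 1) y)\<close>.  As \<open>|E|\<close> is the sum of the \<open>d v\<close>, the
  required bound says \<open>\<Sum>v. g (d v) \<le> g n\<close>.  Both sides vanish at \<open>y = 0\<close>, and the derivative
  of \<open>g k\<close> in \<open>y\<close> is \<open>- y / (1 - y)\<close> times \<open>k (k - 1) / (1 + (k - 1) y)\<close>.  Since \<open>d v \<le> n\<close>,
  replacing each denominator \<open>1 + (d v - 1) y\<close> by \<open>1 + (n - 1) y\<close> does not increase the fraction, and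
  what remains to be compared is exactly \<open>\<Sum>v. d v (d v - 1) \<ge> n (n - 1)\<close>
  (\<open>degree_log_inequality\<close>).
\<close>

section \<open>Two determinant evaluations\<close>

text \<open>
  A permutation that fixes every index other than \<open>k\<close> is the identity, so only one term of the
  Leibniz expansion survives.
\<close>

lemma det_single_free_row:
  fixes w a :: "'v::finite \<Rightarrow> 'a::comm_ring_1"
  shows "det (\<chi> i j. if i = k then w j else if i = j then a i else 0)
    = w k * (\<Prod>i\<in>UNIV - {k}. a i)"
proof -
  let ?B = "(\<chi> i j. if i = k then w j else if i = j then a i else 0) :: 'a^'v^'v"
  let ?t = "\<lambda>p. of_int (sign p) * (\<Prod>i\<in>UNIV. ?B $ i $ p i)"
  have zero: "?t p = 0" if p: "p permutes (UNIV :: 'v set)" "p \<noteq> id" for p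
  proof -
    have "\<exists>i. i \<noteq> k \<and> p i \<noteq> i"
    proof (rule ccontr)
      assume "\<nexists>i. i \<noteq> k \<and> p i \<noteq> i"
      then have fixed: "p i = i" if "i \<noteq> k" for i using that by blast
      have "p k = k"
        using fixed permutes_inj[OF p(1)] by (metis injD)
      with fixed have "p = id" by (metis eq_id_iff)
      with p(2) show False by simp
    qed
    then obtain i where "i \<noteq> k" "p i \<noteq> i" by blast
    then have "?B $ i $ p i = 0" by auto
    then have "(\<Prod>i\<in>UNIV. ?B $ i $ p i) = 0" by (intro prod_zero bexI[of _ i]) auto
    then show ?thesis by simp
  qed
  have "det ?B = (\<Sum>p\<in>{id}. ?t p)"
    unfolding det_def
    by (rule sum.mono_neutral_right) (use zero in \<open>auto simp: permutes_id\<close>)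
  also have "\<dots> = (\<Prod>i\<in>UNIV. ?B $ i $ i)" by simp
  also have "\<dots> = ?B $ k $ k * (\<Prod>i\<in>UNIV - {k}. ?B $ i $ i)"
    by (subst prod.remove[of UNIV k]) auto
  also have "(\<Prod>i\<in>UNIV - {k}. ?B $ i $ i) = (\<Prod>i\<in>UNIV - {k}. a i)"
    by (rule prod.cong) auto
  finally show ?thesis by simp
qed

lemma det_subtract_free_row:
  fixes w a :: "'v::finite \<Rightarrow> 'a::comm_ring_1"
  assumes "finite S" "k \<notin> S"
  shows "det (\<chi> i j. if i = k then w j else (if i = j then a i else 0) + (if i \<in> S then w j else 0))
    = det (\<chi> i j. if i = k then w j else if i = j then a i else 0)"
  using assms
proof (induction S rule: finite_induct)
  case (insert s S)
  let ?A = "(\<chi> i j. if i = k then w j else (if i = j then a i else 0) + (if i \<in> S then w j else 0)) :: 'a^'v^'v"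
  have "(\<chi> i j. if i = k then w j else (if i = j then a i else 0) + (if i \<in> insert s S then w j else 0))
     = (\<chi> i. if i = s then row s ?A + 1 *s row k ?A else row i ?A)"
    using insert.hyps insert.prems by (auto simp: vec_eq_iff row_def)
  moreover have "det (\<chi> i. if i = s then row s ?A + 1 *s row k ?A else row i ?A) = det ?A"
    by (rule det_row_operation) (use insert.prems in auto)
  ultimately show ?case using insert by simp
qed (auto simp: vec_eq_iff intro!: arg_cong[where f = det])

text \<open>
  The matrix determinant lemma for \<open>diag a + 1_S w\<^sup>T\<close>, in a form that needs no inverse of
  \<open>diag a\<close>.  Adding \<open>w\<close> to one more row contributes, by linearity in that row, the determinant
  of the matrix in which that row is just \<open>w\<close>; subtracting it from the other rows of \<open>S\<close> leaves
  a single term.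
\<close>

lemma det_diagonal_plus_common_row:
  fixes w a :: "'v::finite \<Rightarrow> 'a::comm_ring_1"
  assumes "finite S"
  shows "det (\<chi> i j. (if i = j then a i else 0) + (if i \<in> S then w j else 0))
    = (\<Prod>i\<in>UNIV. a i) + (\<Sum>k\<in>S. w k * (\<Prod>i\<in>UNIV - {k}. a i))"
  using assms
proof (induction S rule: finite_induct)
  case empty
  show ?case by (subst det_diagonal) auto
next
  case (insert k S)
  let ?R = "\<lambda>i j. (if i = j then a i else 0) + (if i \<in> S then w j else 0)"
  have "det (\<chi> i j. (if i = j then a i else 0) + (if i \<in> insert k S then w j else 0))
    = det (\<chi> i. if i = k then (\<chi> j. ?R k j) + (\<chi> j. w j) else (\<chi> j. ?R i j))"
    using insert.hyps by (intro arg_cong[where f = det]) (auto simp: vec_eq_iff)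
  also have "\<dots> = det (\<chi> i. if i = k then (\<chi> j. ?R k j) else (\<chi> j. ?R i j))
      + det (\<chi> i. if i = k then (\<chi> j. w j) else (\<chi> j. ?R i j))"
    by (rule det_row_add)
  also have "(\<chi> i. if i = k then (\<chi> j. ?R k j) else (\<chi> j. ?R i j)) = (\<chi> i j. ?R i j)"
    by (auto simp: vec_eq_iff)
  also have "(\<chi> i. if i = k then (\<chi> j. w j) else (\<chi> j. ?R i j)) =
      (\<chi> i j. if i = k then w j else ?R i j)"
    by (auto simp: vec_eq_iff)
  also have "det \<dots> = w k * (\<Prod>i\<in>UNIV - {k}. a i)"
    by (simp only: det_subtract_free_row[OF insert.hyps] det_single_free_row)
  finally show ?case using insert by simp
qed

text \<open>
  Ordering the indices with \<open>W\<close> last would make the matrix unitriangular, but the index type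
  carries no order.  Instead: \<open>C\<close> squares to zero, so \<open>mat 1 - C\<close> is the inverse of
  \<open>mat 1 + C\<close>, and flipping the signs on \<open>W\<close> conjugates one into the other.  This gives
  the determinant up to sign, which suffices for a congruence.
\<close>

lemma det_bipartite_unipotent_sq:
  fixes C :: "real^'v::finite^'v"
  assumes supp: "\<And>i j. C $ i $ j \<noteq> 0 \<Longrightarrow> i \<in> W \<and> j \<notin> W"
  shows "(det (mat 1 + C))\<^sup>2 = 1"
proof -
  define S :: "real^'v^'v" where "S = (\<chi> i j. if i = j then (if i \<in> W then -1 else 1) else 0)"
  have CC: "C ** C = 0"
    using supp by (auto simp: vec_eq_iff matrix_matrix_mult_def intro!: sum.neutral) metis
  have inv: "(mat 1 + C) ** (mat 1 - C) = mat 1"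
  proof -
    have "(mat 1 + C) ** (mat 1 - C) = (mat 1 - C) + C ** (mat 1 - C)"
      by (simp add: matrix_eq matrix_vector_mult_add_rdistrib flip: matrix_vector_mul_assoc)
    also have "C ** (mat 1 - C) = C"
      using matrix_add_ldistrib[of C "mat 1 - C" C] CC by simp
    finally show ?thesis by simp
  qed
  have "S ** (mat 1 + C) = (mat 1 - C) ** S"
  proof -
    have "(S ** (mat 1 + C)) $ i $ j = ((mat 1 - C) ** S) $ i $ j" for i j
      using supp[of i j]
      by (auto simp: S_def matrix_matrix_mult_def mat_def if_distrib[where f = "\<lambda>t. t * _"]
          if_distrib[where f = "\<lambda>t. _ * t"] sum.If_cases cong: if_cong)
    then show ?thesis by (simp add: vec_eq_iff)
  qed
  then have "det S * det (mat 1 + C) = det (mat 1 - C) * det S"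
    by (metis det_mul)
  moreover have "det S \<noteq> 0"
    unfolding S_def by (subst det_diagonal) auto
  ultimately have "det (mat 1 + C) = det (mat 1 - C)" by simp
  with inv show ?thesis
    by (metis det_I det_mul power2_eq_square)
qed

section \<open>Existence of a determinant maximizer\<close>

definition psd :: "real^'v::finite^'v \<Rightarrow> bool" where
  "psd M \<longleftrightarrow> transpose M = M \<and> (\<forall>z. z \<bullet> (M *v z) \<ge> 0)"

lemma positive_definite_imp_psd: "positive_definite M \<Longrightarrow> psd M"
  unfolding psd_def positive_definite_def
  by (metis inner_zero_left order.refl less_imp_le)

lemma inner_axis_matrix: "axis i 1 \<bullet> (M *v axis j 1) = (M $ i $ j :: real)"
  by (simp add: inner_axis' matrix_vector_mul_component inner_axis)

lemma inner_matrix_symmetric: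
  fixes M :: "real^'v::finite^'v"
  assumes "transpose M = M"
  shows "w \<bullet> (M *v z) = z \<bullet> (M *v w)"
  by (metis assms dot_lmul_matrix inner_commute vector_transpose_matrix)

lemma quadratic_form_add_scaled:
  fixes M :: "real^'v::finite^'v"
  assumes "transpose M = M"
  shows "(z + t *\<^sub>R w) \<bullet> (M *v (z + t *\<^sub>R w))
    = z \<bullet> (M *v z) + 2 * t * (w \<bullet> (M *v z)) + t\<^sup>2 * (w \<bullet> (M *v w))"
  using inner_matrix_symmetric[OF assms, of w z]
  by (simp add: matrix_vector_right_distrib inner_left_distrib inner_right_distrib
      matrix_vector_mult_scaleR power2_eq_square distrib_left)

text \<open>
  If a semidefinite form vanished at \<open>z\<close> while \<open>M *v z \<noteq> 0\<close>, moving from \<open>z\<close> a little in the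
  direction \<open>- M *v z\<close> would make it negative.
\<close>

lemma psd_det_nonzero_imp_positive_definite:
  fixes M :: "real^'v::finite^'v"
  assumes "psd M" "det M \<noteq> 0"
  shows "positive_definite M"
proof -
  have sym: "transpose M = M" and nonneg: "\<And>z. z \<bullet> (M *v z) \<ge> 0"
    using assms(1) by (auto simp: psd_def)
  have "z \<bullet> (M *v z) > 0" if "z \<noteq> 0" for z
  proof (rule ccontr)
    assume "\<not> ?thesis"
    then have z0: "z \<bullet> (M *v z) = 0" using nonneg[of z] by simp
    define w where "w = M *v z"
    have w0: "w \<noteq> 0"
      using assms(2) that unfolding w_def
      by (metis invertible_det_nz matrix_left_invertible_ker invertible_left_inverse)
    define q where "q = w \<bullet> (M *v w)"
    have q: "q \<ge> 0" using nonneg q_def by simp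
    \<comment> \<open>The minimizer is \<open>- (w \<bullet> w) / q\<close>; the \<open>+ 1\<close> avoids a case distinction on \<open>q = 0\<close>.\<close>
    define t where "t = - (w \<bullet> w) / (q + 1)"
    have "0 \<le> (z + t *\<^sub>R w) \<bullet> (M *v (z + t *\<^sub>R w))" by (rule nonneg)
    also have "\<dots> = 2 * t * (w \<bullet> w) + t\<^sup>2 * q"
      using z0 by (simp add: quadratic_form_add_scaled[OF sym] q_def flip: w_def)
    also have "\<dots> = - ((w \<bullet> w)\<^sup>2 * (q + 2)) / (q + 1)\<^sup>2"
    proof -
      have "q + 1 \<noteq> 0" using q by simp
      then show ?thesis
        by (simp add: t_def divide_simps power2_eq_square) (simp add: algebra_simps)
    qed
    also have "\<dots> < 0"
      using q w0 by (intro divide_neg_pos) auto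
    finally show False by simp
  qed
  then show ?thesis using sym by (simp add: positive_definite_def)
qed

lemma psd_unit_diagonal_entry_bound:
  fixes M :: "real^'v::finite^'v"
  assumes "psd M" "\<And>i. M $ i $ i = 1"
  shows "\<bar>M $ i $ j\<bar> \<le> 1"
proof -
  have sym: "transpose M = M" using assms(1) by (simp add: psd_def)
  have sym': "M $ j $ i = M $ i $ j"
    using sym by (metis transpose_def vec_lambda_beta)
  have "0 \<le> 1 + 2 * s * M $ i $ j + s\<^sup>2" for s
  proof -
    have "0 \<le> (axis i 1 + s *\<^sub>R axis j 1) \<bullet> (M *v (axis i 1 + s *\<^sub>R axis j 1))"
      using assms(1) by (simp add: psd_def)
    then show ?thesis
      by (simp add: quadratic_form_add_scaled[OF sym] inner_axis_matrix assms(2) sym')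
  qed
  from this[of 1] this[of "-1"] show ?thesis by simp
qed

text \<open>
  \<open>\<Psi>(G,x)\<close> need not be closed, so a maximizer is found in the compact set \<open>K\<close> that also admits
  semidefinite matrices.  It has positive determinant because \<open>M\<close> does, hence it is definite and
  lies in \<open>\<Psi>(G,x)\<close>.  The value of \<open>tau\<close> is thus a genuine maximum, whichever maximizer
  \<open>arg_max\<close> selects.
\<close>

lemma tau_ge_det:
  fixes E :: "'v::finite set set"
  assumes "M \<in> Psi E x" "det M > 0"
  shows "tau E x \<ge> det M"
proof -
  define K where "K = {M :: real^'v^'v. psd M \<and> (\<forall>i. M $ i $ i = 1) \<and>
                 (\<forall>i j. {i, j} \<in> E \<longrightarrow> M $ i $ j = x)}"
  have K: "K = {M. \<forall>i j. M $ j $ i = M $ i $ j} \<inter> {M. \<forall>z. z \<bullet> (M *v z) \<ge> 0} \<inter> {M. \<forall>i. M $ i $ i = 1}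
      \<inter> {M. \<forall>i j. {i, j} \<in> E \<longrightarrow> M $ i $ j = x}"
    by (auto simp: K_def psd_def transpose_def vec_eq_iff)
  have "closed K"
    unfolding K matrix_vector_mult_def inner_vec_def
    by (intro closed_Int closed_Collect_all closed_Collect_eq closed_Collect_le closed_Collect_imp
        open_Collect_const continuous_intros)
  moreover have "bounded K"
  proof (rule boundedI)
    fix M assume "M \<in> K"
    then have "\<bar>M $ i $ j\<bar> \<le> 1" for i j
      using psd_unit_diagonal_entry_bound K_def by blast
    then have row: "norm (M $ i) \<le> real CARD('v)" for i
      by (intro order_trans[OF norm_le_l1_cart sum_bounded_above[where K = 1, THEN order_trans]]) auto
    show "norm M \<le> real CARD('v) * real CARD('v)"
      unfolding norm_vec_def[of M]
      by (rule order_trans[OF L2_set_le_sum sum_bounded_above]) (use row in auto)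
  qed
  ultimately have "compact K" by (simp add: compact_eq_bounded_closed)
  moreover have "M \<in> K"
    using assms(1) positive_definite_imp_psd by (auto simp: K_def Psi_def)
  moreover have "continuous_on K det"
    unfolding det_def by (intro continuous_intros)
  ultimately obtain A where A: "A \<in> K" "\<And>B. B \<in> K \<Longrightarrow> det B \<le> det A"
    using continuous_attains_sup[of K det] by blast
  have "det A > 0" using A(2)[OF \<open>M \<in> K\<close>] assms(2) by simp
  then have "A \<in> Psi E x"
    using A(1) psd_det_nonzero_imp_positive_definite[of A] by (auto simp: K_def Psi_def)
  moreover have "det B \<le> det A" if "B \<in> Psi E x" for B
    using that A(2) positive_definite_imp_psd by (auto simp: K_def Psi_def)
  ultimately have "tau E x = det A"
    unfolding tau_def Sigma_mat_def by (intro arg_max_equality)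
  then show ?thesis using A(2)[OF \<open>M \<in> K\<close>] by simp
qed

section \<open>The inequality for the degrees\<close>

lemma one_plus_pred_mult_pos:
  fixes y :: real
  assumes "0 \<le> y" "y < 1"
  shows "1 + (real d - 1) * y > 0"
proof -
  have "1 + (real d - 1) * y = (1 - y) + real d * y" by (simp add: algebra_simps)
  also have "\<dots> > 0" using assms by (intro add_pos_nonneg) auto
  finally show ?thesis .
qed

text \<open>
  The function \<open>g k\<close> is the logarithm of the determinant \<open>(1 - t)^(k-1) (1 + (k-1) t)\<close> of the
  \<open>k \<times> k\<close> matrix with unit diagonal and all other entries \<open>t\<close>.  Both sides agree at \<open>0\<close>, so it
  suffices to compare derivatives, which is where the degree condition enters.
\<close>

lemma degree_log_inequality:
  fixes d :: "'a \<Rightarrow> nat" and n :: nat and y :: real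
  assumes "finite S" and y: "0 \<le> y" "y < 1"
    and le: "\<And>v. v \<in> S \<Longrightarrow> d v \<le> n"
    and deg: "(\<Sum>v\<in>S. real (d v) * (real (d v) - 1)) \<ge> real n * (real n - 1)"
  defines "g \<equiv> \<lambda>k::nat. \<lambda>t::real. (real k - 1) * ln (1 - t) + ln (1 + (real k - 1) * t)"
  shows "(\<Sum>v\<in>S. g (d v) y) \<le> g n y"
proof -
  define g' where "g' = (\<lambda>k::nat. \<lambda>t::real. - (t / (1 - t)) * (real k * (real k - 1) / (1 + (real k - 1) * t)))"
  have g': "(g k has_real_derivative g' k t) (at t)" if "0 \<le> t" "t < 1" for k t
  proof -
    have p: "1 + (real k - 1) * t > 0" using one_plus_pred_mult_pos that by blast
    have "(g k has_real_derivative
        (real k - 1) * (- 1 / (1 - t)) + (real k - 1) / (1 + (real k - 1) * t)) (at t)"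
      unfolding g_def using p that by (auto intro!: derivative_eq_intros simp: divide_inverse)
    also have "(real k - 1) * (- 1 / (1 - t)) + (real k - 1) / (1 + (real k - 1) * t) = g' k t"
    proof -
      have "1 - t \<noteq> 0" "1 + (real k - 1) * t \<noteq> 0" using p that by auto
      then show ?thesis unfolding g'_def
        by (simp add: divide_simps) (simp add: algebra_simps)
    qed
    finally show ?thesis .
  qed
  have mono: "(\<Sum>v\<in>S. g' (d v) t) \<le> g' n t" if t: "0 \<le> t" "t < 1" for t
  proof -
    have "real n * (real n - 1) / (1 + (real n - 1) * t)
       \<le> (\<Sum>v\<in>S. real (d v) * (real (d v) - 1)) / (1 + (real n - 1) * t)"
      using deg one_plus_pred_mult_pos[OF t, of n] by (simp add: divide_right_mono)
    also have "\<dots> \<le> (\<Sum>v\<in>S. real (d v) * (real (d v) - 1) / (1 + (real (d v) - 1) * t))"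
      unfolding sum_divide_distrib
    proof (rule sum_mono)
      fix v assume "v \<in> S"
      \<comment> \<open>For degree \<open>0\<close> the factor \<open>real (d v) - 1\<close> is negative, but the product is zero.\<close>
      have "0 \<le> real (d v) * (real (d v) - 1)" by (cases "d v") auto
      moreover have "1 + (real (d v) - 1) * t \<le> 1 + (real n - 1) * t"
        using le[OF \<open>v \<in> S\<close>] t by (simp add: mult_right_mono)
      ultimately show "real (d v) * (real (d v) - 1) / (1 + (real n - 1) * t)
          \<le> real (d v) * (real (d v) - 1) / (1 + (real (d v) - 1) * t)"
        using one_plus_pred_mult_pos[OF t] by (intro divide_left_mono) auto
    qed
    finally have "t / (1 - t) * (real n * (real n - 1) / (1 + (real n - 1) * t))
       \<le> t / (1 - t) * (\<Sum>v\<in>S. real (d v) * (real (d v) - 1) / (1 + (real (d v) - 1) * t))"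
      using t by (intro mult_left_mono) auto
    then show ?thesis by (simp add: g'_def sum_distrib_left sum_negf)
  qed
  have "g n 0 - (\<Sum>v\<in>S. g (d v) 0) \<le> g n y - (\<Sum>v\<in>S. g (d v) y)"
  proof (rule DERIV_nonneg_imp_nondecreasing[OF y(1)])
    fix t assume "0 \<le> t" "t \<le> y"
    then have t: "0 \<le> t" "t < 1" using y by auto
    have "((\<lambda>t. g n t - (\<Sum>v\<in>S. g (d v) t)) has_real_derivative g' n t - (\<Sum>v\<in>S. g' (d v) t)) (at t)"
      by (intro DERIV_diff DERIV_sum g' t)
    then show "\<exists>D. ((\<lambda>t. g n t - (\<Sum>v\<in>S. g (d v) t)) has_real_derivative D) (at t) \<and> 0 \<le> D"
      using mono[OF t] by (intro exI conjI) auto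
  qed
  then show ?thesis by (simp add: g_def)
qed

text \<open>
  The exponentiated form, with \<open>(1 - y)^(n-1) (1 + (n-1) y)\<close> expanded so that the natural-number
  exponent \<open>n - 1\<close> also gives the right value, \<open>1\<close>, when \<open>n = 0\<close>.
\<close>

lemma degree_product_inequality:
  fixes d :: "'a \<Rightarrow> nat" and n :: nat and y :: real
  assumes "finite S" and y: "0 \<le> y" "y < 1"
    and le: "\<And>v. v \<in> S \<Longrightarrow> d v \<le> n"
    and deg: "(\<Sum>v\<in>S. real (d v) * (real (d v) - 1)) \<ge> real n * (real n - 1)"
  shows "(1 - y) ^ (\<Sum>v\<in>S. d v) \<le>
    ((1 - y) ^ n + real n * y * (1 - y) ^ (n - 1)) * (\<Prod>v\<in>S. (1 - y) / (1 + (real (d v) - 1) * y))"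
proof -
  let ?q = "\<lambda>k::nat. 1 + (real k - 1) * y"
  let ?g = "\<lambda>k::nat. (real k - 1) * ln (1 - y) + ln (?q k)"
  have q: "?q k > 0" for k using one_plus_pred_mult_pos[OF y] .
  have y1: "1 - y > 0" using y by simp
  have n: "(1 - y) ^ n + real n * y * (1 - y) ^ (n - 1) = exp (?g n)"
  proof -
    have "exp (?g n) * (1 - y) = exp (real n * ln (1 - y)) * ?q n"
    proof -
      have "exp (?g n) * exp (ln (1 - y)) = exp (real n * ln (1 - y)) * exp (ln (?q n))"
        unfolding exp_add[symmetric] by (simp add: algebra_simps)
      then show ?thesis using q[of n] y1 by simp
    qed
    also have "\<dots> = (1 - y) ^ n * ?q n"
      using y1 by (simp add: exp_of_nat_mult)
    also have "\<dots> = ((1 - y) ^ n + real n * y * (1 - y) ^ (n - 1)) * (1 - y)"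
      by (cases n) (simp_all add: algebra_simps)
    finally show ?thesis using y1 by simp
  qed
  have d: "(1 - y) / ?q k = exp (real k * ln (1 - y) - ?g k)" for k
  proof -
    have "exp (real k * ln (1 - y) - ?g k) = exp (ln (1 - y) - ln (?q k))"
      by (simp add: algebra_simps)
    also have "\<dots> = (1 - y) / ?q k"
      using q[of k] y1 by (simp add: exp_diff)
    finally show ?thesis by simp
  qed
  have "(1 - y) ^ (\<Sum>v\<in>S. d v) = exp (\<Sum>v\<in>S. real (d v) * ln (1 - y))"
    using y1 by (simp add: exp_of_nat_mult sum_distrib_right[symmetric] of_nat_sum[symmetric] del: of_nat_sum)
  also have "\<dots> \<le> exp (?g n + (\<Sum>v\<in>S. real (d v) * ln (1 - y) - ?g (d v)))"
    using degree_log_inequality[OF assms] by (simp add: sum_subtractf)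
  also have "\<dots> = exp (?g n) * (\<Prod>v\<in>S. (1 - y) / ?q (d v))"
    unfolding d using assms(1) by (simp add: exp_add exp_sum)
  finally show ?thesis unfolding n .
qed

section \<open>Degrees in bipartite graphs\<close>

lemma vdeg_eq_card_neighbours:
  fixes E :: "'v::finite set set"
  assumes "bipartite_with E V1 V2"
  shows "vdeg E v = card {u. {u, v} \<in> E}"
proof -
  have "{e \<in> E. v \<in> e} = (\<lambda>u. {u, v}) ` {u. {u, v} \<in> E}"
  proof (intro equalityI subsetI)
    fix e assume "e \<in> {e \<in> E. v \<in> e}"
    then obtain a b where "e \<in> E" "e = {a, b}" "v = a \<or> v = b"
      using assms unfolding bipartite_with_def by fast
    then show "e \<in> (\<lambda>u. {u, v}) ` {u. {u, v} \<in> E}" by (auto simp: insert_commute)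
  qed auto
  moreover have "inj_on (\<lambda>u. {u, v}) {u. {u, v} \<in> E}"
    by (auto simp: inj_on_def doubleton_eq_iff)
  ultimately show ?thesis by (simp add: vdeg_def card_image)
qed

lemma bipartite_neighbour:
  assumes "bipartite_with E V1 V2" "{u, v} \<in> E" "v \<in> V2"
  shows "u \<in> V1"
proof -
  obtain a b where "a \<in> V1" "b \<in> V2" "{u, v} = {a, b}"
    using assms(1,2) unfolding bipartite_with_def by meson
  moreover have "v \<notin> V1" using assms(1,3) unfolding bipartite_with_def by blast
  ultimately show ?thesis by (auto simp: doubleton_eq_iff)
qed

lemma card_edges_eq_sum_vdeg:
  fixes E :: "'v::finite set set"
  assumes "bipartite_with E V1 V2"
  shows "card E = (\<Sum>v\<in>V2. vdeg E v)"
proof -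
  have "E = (\<Union>v\<in>V2. {e \<in> E. v \<in> e})"
    using assms unfolding bipartite_with_def by fast
  also have "card \<dots> = (\<Sum>v\<in>V2. card {e \<in> E. v \<in> e})"
  proof (intro card_UN_disjoint ballI impI)
    fix v v' assume v: "v \<in> V2" "v' \<in> V2" "v \<noteq> v'"
    show "{e \<in> E. v \<in> e} \<inter> {e \<in> E. v' \<in> e} = {}"
    proof (rule equals0I)
      fix e assume e: "e \<in> {e \<in> E. v \<in> e} \<inter> {e \<in> E. v' \<in> e}"
      then obtain a b where "a \<in> V1" "b \<in> V2" "e = {a, b}"
        using assms unfolding bipartite_with_def by fast
      then have "v = a \<or> v' = a" using e v(3) by auto
      then show False
        using v \<open>a \<in> V1\<close> assms unfolding bipartite_with_def by blast
    qed
  qed auto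
  finally show ?thesis by (simp add: vdeg_def)
qed

section \<open>The covariance matrix\<close>

lemma positive_definite_congruence:
  fixes L D :: "real^'v::finite^'v"
  assumes "positive_definite D" "det L \<noteq> 0"
  shows "positive_definite (L ** D ** transpose L)"
  unfolding positive_definite_def
proof (intro conjI allI impI)
  show "transpose (L ** D ** transpose L) = L ** D ** transpose L"
    using assms(1) by (simp add: positive_definite_def matrix_transpose_mul matrix_mul_assoc)
  fix z :: "real^'v" assume "z \<noteq> 0"
  have "det (transpose L) \<noteq> 0" using assms(2) by simp
  then have "transpose L *v z \<noteq> 0"
    using \<open>z \<noteq> 0\<close>
    by (metis invertible_det_nz matrix_left_invertible_ker invertible_left_inverse)
  then have "0 < (transpose L *v z) \<bullet> (D *v (transpose L *v z))"
    using assms(1) by (simp add: positive_definite_def)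
  also have "\<dots> = z \<bullet> ((L ** D ** transpose L) *v z)"
    by (metis dot_lmul_matrix matrix_vector_mul_assoc vector_transpose_matrix transpose_transpose)
  finally show "0 < z \<bullet> ((L ** D ** transpose L) *v z)" .
qed

text \<open>
  The covariance of two linear combinations, with coefficient rows \<open>i\<close> and \<open>j\<close> of \<open>L\<close>, of
  independent variables with variances \<open>a\<close> plus a common component of variance \<open>y\<close> on \<open>V\<close>.
\<close>

lemma diagonal_plus_block_entry:
  fixes L :: "real^'v::finite^'v" and a :: "'v \<Rightarrow> real" and V :: "'v set" and y :: real
  defines "D \<equiv> (\<chi> i j. (if i = j then a i else 0) + (if i \<in> V then if j \<in> V then y else 0 else 0))"
  shows "(L ** D ** transpose L) $ i $ j =
    (\<Sum>k\<in>UNIV. a k * L $ i $ k * L $ j $ k) + y * (\<Sum>k\<in>V. L $ i $ k) * (\<Sum>k\<in>V. L $ j $ k)"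
proof -
  have LD: "(L ** D) $ i $ k = a k * L $ i $ k + (if k \<in> V then y * (\<Sum>l\<in>V. L $ i $ l) else 0)" for k
    by (simp add: D_def matrix_matrix_mult_def algebra_simps sum.distrib sum_distrib_left
        if_distrib[where f = "\<lambda>t. _ * t"] sum.If_cases cong: if_cong)
  have "(L ** D ** transpose L) $ i $ j = (\<Sum>k\<in>UNIV. (L ** D) $ i $ k * L $ j $ k)"
    by (simp add: matrix_matrix_mult_def[of "L ** D"] transpose_def)
  also have "\<dots> = (\<Sum>k\<in>UNIV. a k * L $ i $ k * L $ j $ k +
      (if k \<in> V then y * (\<Sum>l\<in>V. L $ i $ l) * L $ j $ k else 0))"
    by (rule sum.cong) (auto simp: LD distrib_right)
  also have "\<dots> = (\<Sum>k\<in>UNIV. a k * L $ i $ k * L $ j $ k)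
      + y * (\<Sum>k\<in>V. L $ i $ k) * (\<Sum>k\<in>V. L $ j $ k)"
    by (simp add: sum.distrib sum.If_cases flip: sum_distrib_left)
  finally show ?thesis .
qed

lemma diagonal_plus_block_positive_definite:
  fixes a :: "'v::finite \<Rightarrow> real"
  assumes "\<And>i. a i > 0" "y \<ge> 0"
  shows "positive_definite (\<chi> i j. (if i = j then a i else 0) + (if i \<in> V then if j \<in> V then y else 0 else 0))"
    (is "positive_definite ?D")
  unfolding positive_definite_def
proof (intro conjI allI impI)
  show "transpose ?D = ?D" by (auto simp: transpose_def vec_eq_iff)
  fix z :: "real^'v" assume "z \<noteq> 0"
  then obtain k where "z $ k \<noteq> 0" by (auto simp: vec_eq_iff)
  have "?D *v z = (\<chi> i. a i * z $ i + (if i \<in> V then y * (\<Sum>j\<in>V. z $ j) else 0))"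
    by (simp add: vec_eq_iff matrix_vector_mult_def algebra_simps sum.distrib sum_distrib_left
        if_distrib[where f = "\<lambda>t. _ * t"] sum.If_cases cong: if_cong)
  then have "z \<bullet> (?D *v z) = (\<Sum>i\<in>UNIV. a i * (z $ i)\<^sup>2) + y * (\<Sum>j\<in>V. z $ j)\<^sup>2"
    by (simp add: inner_vec_def algebra_simps sum.distrib sum_distrib_left power2_eq_square
        if_distrib[where f = "\<lambda>t. _ * t"] sum.If_cases cong: if_cong)
  moreover have "(\<Sum>i\<in>UNIV. a i * (z $ i)\<^sup>2) > 0"
    using assms(1) \<open>z $ k \<noteq> 0\<close> by (intro sum_pos2[of _ k]) (auto simp: less_imp_le)
  ultimately show "0 < z \<bullet> (?D *v z)" using assms(2) by (simp add: add_pos_nonneg)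
qed

text \<open>
  The covariance matrix is built as \<open>M = L D L\<^sup>T\<close>.  Here \<open>D\<close> is the covariance of the variables
  on \<open>V1\<close> together with the independent noises on \<open>V2\<close>, and row \<open>v \<in> V2\<close> of \<open>L\<close> expresses
  the variable at \<open>v\<close> as its noise plus \<open>c v\<close> times the sum over its neighbours \<open>N v\<close>.
\<close>

lemma Psi_bipartite_witness:
  fixes E :: "'v::finite set set" and V1 V2 :: "'v set"
  assumes bip: "bipartite_with E V1 V2" and x: "x \<in> {-1<..<1::real}"
  shows "\<exists>M \<in> Psi E x. det M =
    ((1 - x\<^sup>2) ^ card V1 + real (card V1) * x\<^sup>2 * (1 - x\<^sup>2) ^ (card V1 - 1)) *
    (\<Prod>v\<in>V2. (1 - x\<^sup>2) / (1 + (real (vdeg E v) - 1) * x\<^sup>2))"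
proof -
  define y where "y = x\<^sup>2"
  have y: "0 \<le> y" "y < 1" using x by (auto simp: y_def abs_square_less_1)
  define q where "q = (\<lambda>v. 1 + (real (vdeg E v) - 1) * y)"
  have q: "q v > 0" for v unfolding q_def using one_plus_pred_mult_pos[OF y] .
  define c where "c = (\<lambda>v. x / q v)"
  define N where "N = (\<lambda>v. {u. {u, v} \<in> E})"
  have V: "V2 = - V1" using bip unfolding bipartite_with_def by blast
  have N: "N v \<subseteq> V1" if "v \<in> V2" for v
    using bipartite_neighbour[OF bip _ that] by (auto simp: N_def)
  have cN: "card (N v) = vdeg E v" for v
    by (simp add: N_def vdeg_eq_card_neighbours[OF bip])
  define a where "a = (\<lambda>i. if i \<in> V1 then 1 - y else (1 - y) / q i)"
  have a: "a i > 0" for i using q[of i] y by (simp add: a_def)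
  define C :: "real^'v^'v" where "C = (\<chi> i j. if i \<in> V2 \<and> j \<in> N i then c i else 0)"
  define L where "L = mat 1 + C"
  define D :: "real^'v^'v" where
    "D = (\<chi> i j. (if i = j then a i else 0) + (if i \<in> V1 then if j \<in> V1 then y else 0 else 0))"
  define M where "M = L ** D ** transpose L"
  have detL: "(det L)\<^sup>2 = 1"
    unfolding L_def
    by (rule det_bipartite_unipotent_sq[where W = V2]) (use N V in \<open>auto simp: C_def split: if_splits\<close>)
  have entry: "M $ i $ j = (\<Sum>k\<in>UNIV. a k * L $ i $ k * L $ j $ k)
      + y * (\<Sum>k\<in>V1. L $ i $ k) * (\<Sum>k\<in>V1. L $ j $ k)" for i j
    unfolding M_def D_def by (rule diagonal_plus_block_entry)
  have L1: "L $ u $ k = (if u = k then 1 else 0)" if "u \<in> V1" for u k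
    using that V by (simp add: L_def C_def mat_def)
  have L2: "L $ v $ k = (if v = k then 1 else 0) + (if k \<in> N v then c v else 0)" if "v \<in> V2" for v k
    using that by (simp add: L_def C_def mat_def)
  have s1: "(\<Sum>k\<in>V1. L $ u $ k) = 1" if "u \<in> V1" for u
    using that by (simp add: L1)
  have s2: "(\<Sum>k\<in>V1. L $ v $ k) = c v * vdeg E v" if "v \<in> V2" for v
    using that V N[OF that] by (simp add: L2 sum.distrib sum.If_cases cN Int_absorb1)
  have w1: "(\<Sum>k\<in>UNIV. a k * L $ u $ k * L $ j $ k) = a u * L $ j $ u" if "u \<in> V1" for u j
    using that by (simp add: L1 if_distrib[where f = "\<lambda>t. t * _"] if_distrib[where f = "\<lambda>t. _ * t"] cong: if_cong)
  have diag1: "M $ u $ u = 1" if "u \<in> V1" for u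
    unfolding entry w1[OF that] s1[OF that] using that by (simp add: L1 a_def)
  have edge: "M $ u $ v = x" if "u \<in> V1" "v \<in> V2" "{u, v} \<in> E" for u v
  proof -
    have "M $ u $ v = (1 - y) * c v + y * (c v * vdeg E v)"
      unfolding entry w1[OF that(1)] s1[OF that(1)] s2[OF that(2)]
      using that V by (auto simp: L2[OF that(2)] a_def N_def)
    also have "\<dots> = c v * q v" by (simp add: q_def algebra_simps)
    finally show ?thesis using q[of v] by (simp add: c_def)
  qed
  have diag2: "M $ v $ v = 1" if v: "v \<in> V2" for v
  proof -
    have vN: "v \<notin> N v" using N[OF v] V v by blast
    have "(\<Sum>k\<in>UNIV. a k * L $ v $ k * L $ v $ k)
        = (\<Sum>k\<in>UNIV. (if v = k then a k else 0) + (if k \<in> N v then (1 - y) * (c v)\<^sup>2 else 0))"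
      by (rule sum.cong) (use vN N[OF v] in \<open>auto simp: L2[OF v] a_def power2_eq_square\<close>)
    also have "\<dots> = a v + (1 - y) * (c v)\<^sup>2 * vdeg E v"
      by (simp add: sum.distrib sum.If_cases cN)
    finally have "M $ v $ v = a v + (c v)\<^sup>2 * vdeg E v * q v"
      unfolding entry s2[OF v] by (simp add: q_def algebra_simps power2_eq_square)
    also have "\<dots> = (1 - y) / q v + y * vdeg E v / q v"
      using v V q[of v] by (simp add: a_def c_def y_def power2_eq_square)
    also have "\<dots> = q v / q v" by (simp add: q_def algebra_simps flip: add_divide_distrib)
    finally show ?thesis using q[of v] by simp
  qed
  have pd: "positive_definite M"
    unfolding M_def
    by (rule positive_definite_congruence)
      (use detL diagonal_plus_block_positive_definite[OF a y(1)] in \<open>auto simp: D_def\<close>)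
  have "M \<in> Psi E x"
  proof -
    have "M $ i $ i = 1" for i using diag1 diag2 V by blast
    moreover have "M $ i $ j = x" if "{i, j} \<in> E" for i j
    proof -
      obtain u v where uv: "u \<in> V1" "v \<in> V2" "{i, j} = {u, v}"
        using \<open>{i, j} \<in> E\<close> bip unfolding bipartite_with_def by meson
      have "transpose M $ u $ v = M $ u $ v"
        using pd by (simp add: positive_definite_def)
      then have "M $ v $ u = M $ u $ v" by (simp add: transpose_def)
      moreover have "M $ u $ v = x" using edge[OF uv(1,2)] uv(3) that by simp
      ultimately show ?thesis using uv(3) by (auto simp: doubleton_eq_iff)
    qed
    ultimately show ?thesis using pd by (simp add: Psi_def)
  qed
  moreover have "det M = ((1 - y) ^ card V1 + real (card V1) * y * (1 - y) ^ (card V1 - 1)) *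
    (\<Prod>v\<in>V2. (1 - y) / q v)"
  proof -
    have split: "(\<Prod>i\<in>UNIV - A. a i) = (\<Prod>i\<in>V1 - A. a i) * (\<Prod>v\<in>V2. (1 - y) / q v)" if "A \<subseteq> V1" for A
    proof -
      have "UNIV - A = (V1 - A) \<union> V2" using that V by blast
      then have "(\<Prod>i\<in>UNIV - A. a i) = (\<Prod>i\<in>V1 - A. a i) * (\<Prod>v\<in>V2. a v)"
        using V by (simp only:) (rule prod.union_disjoint; auto)
      then show ?thesis using V by (simp add: a_def)
    qed
    have P: "(\<Prod>i\<in>V1 - A. a i) = (1 - y) ^ card (V1 - A)" for A
      by (simp add: a_def)
    have "det M = (det L)\<^sup>2 * det D"
      by (simp add: M_def det_mul power2_eq_square)
    also have "\<dots> = (\<Prod>i\<in>UNIV. a i) + (\<Sum>k\<in>V1. (if k \<in> V1 then y else 0) * (\<Prod>i\<in>UNIV - {k}. a i))"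
      unfolding detL D_def by (subst det_diagonal_plus_common_row) auto
    also have "\<dots> = (1 - y) ^ card V1 * (\<Prod>v\<in>V2. (1 - y) / q v) +
        (\<Sum>k\<in>V1. y * ((1 - y) ^ (card V1 - 1) * (\<Prod>v\<in>V2. (1 - y) / q v)))"
      using split[of "{}"] P[of "{}"] split[of "{k}" for k] P by (simp add: card_Diff_singleton)
    finally show ?thesis by (simp add: algebra_simps)
  qed
  ultimately show ?thesis unfolding q_def y_def by blast
qed

theorem theorem1p5:
  fixes E :: "'v::finite set set" and V1 V2 :: "'v set"
  assumes "simple_graph E"
    and "bipartite_with E V1 V2"
    and "(\<Sum>v\<in>V2. int (vdeg E v) * (int (vdeg E v) - 1)) \<ge> int (card V1) * (int (card V1) - 1)"
  shows "\<forall>x\<in>{-1<..<1::real}. tau E x \<ge> (1 - x\<^sup>2) ^ card E"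
proof
  fix x :: real assume x: "x \<in> {-1<..<1}"
  have x2: "0 \<le> x\<^sup>2" "x\<^sup>2 < 1" using x by (auto simp: abs_square_less_1)
  obtain M where M: "M \<in> Psi E x" "det M =
    ((1 - x\<^sup>2) ^ card V1 + real (card V1) * x\<^sup>2 * (1 - x\<^sup>2) ^ (card V1 - 1)) *
    (\<Prod>v\<in>V2. (1 - x\<^sup>2) / (1 + (real (vdeg E v) - 1) * x\<^sup>2))"
    using Psi_bipartite_witness[OF assms(2) x] by blast
  have le: "vdeg E v \<le> card V1" if "v \<in> V2" for v
    unfolding vdeg_eq_card_neighbours[OF assms(2)]
    using bipartite_neighbour[OF assms(2) _ that] by (intro card_mono) auto
  have "real_of_int (int (card V1) * (int (card V1) - 1))
      \<le> real_of_int (\<Sum>v\<in>V2. int (vdeg E v) * (int (vdeg E v) - 1))"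
    using assms(3) by (simp only: of_int_le_iff)
  then have "real (card V1) * (real (card V1) - 1)
      \<le> (\<Sum>v\<in>V2. real (vdeg E v) * (real (vdeg E v) - 1))"
    by simp
  then have "(1 - x\<^sup>2) ^ card E \<le> det M"
    unfolding M(2) card_edges_eq_sum_vdeg[OF assms(2)]
    using le x2 by (intro degree_product_inequality) auto
  moreover have "0 < (1 - x\<^sup>2) ^ card E" using x2 by simp
  ultimately show "(1 - x\<^sup>2) ^ card E \<le> tau E x"
    using tau_ge_det[OF M(1)] by linarith
qed

end
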